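(* Let $m\geqslant 1$ and $n\geqslant 1$ be integers, let $G$ be a subgroup of the symmetric group $\mathfrak{S}_m$, let $\chi$ be an irreducible (complex) character of $G$, and let $d_\chi^G$ be the associated generalized matrix function ($G$-immanant) on $m\times m$ complex matrices. Let $A_1,\ldots,A_n$ be $m\times m$ Hermitian positive semidefinite complex matrices. Then $$(n-2)\sum_{i=1}^n d_\chi^G(A_i) + d_\chi^G\Bigl(\sum_{i=1}^n A_i\Bigr)\ \geqslant\ \sum_{1\leqslant i<j\leqslant n} d_\chi^G(A_i+A_j).$$
   Context: For a subgroup $G$ of the symmetric group $\mathfrak{S}_m$ and an irreducible character $\chi$ of $G$, the $G$-immanant (generalized matrix function) of an $m\times m$ complex matrix $X=(x_{ij})$ is $d_\chi^G(X):=\sum_{\sigma\in G}\chi(\sigma)\prod_{i=1}^m x_{i,\sigma(i)}$. On Hermitian positive semidefinite matrices its values are real, so the inequality is one between real numbers. *)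

theory Defs
  imports "HOL-Algebra.Sym_Groups" "Jordan_Normal_Form.Schur_Decomposition"
    "Jordan_Normal_Form.VS_Connect"
begin

definition mat_trace :: "complex mat \<Rightarrow> complex" where
  "mat_trace A = (\<Sum>i<dim_row A. A $$ (i, i))"

definition matrix_rep :: "('a, 'b) monoid_scheme \<Rightarrow> nat \<Rightarrow> ('a \<Rightarrow> complex mat) \<Rightarrow> bool" where
  "matrix_rep H d \<rho> \<longleftrightarrow> \<rho> \<in> hom H (units_of (ring_mat TYPE(complex) d ()))"

definition irreducible_rep :: "('a, 'b) monoid_scheme \<Rightarrow> nat \<Rightarrow> ('a \<Rightarrow> complex mat) \<Rightarrow> bool" where
  "irreducible_rep H d \<rho> \<longleftrightarrow>
     matrix_rep H d \<rho> \<and> d > 0 \<and>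
     (\<forall>W. VectorSpace.subspace class_ring W (module_vec TYPE(complex) d) \<longrightarrow>
        (\<forall>g\<in>carrier H. \<forall>w\<in>W. \<rho> g *\<^sub>v w \<in> W) \<longrightarrow>
        W = {0\<^sub>v d} \<or> W = carrier_vec d)"

text \<open>Only the values on the carrier are constrained; elsewhere \<open>\<chi>\<close> is arbitrary.\<close>
definition irreducible_character :: "('a, 'b) monoid_scheme \<Rightarrow> ('a \<Rightarrow> complex) \<Rightarrow> bool" where
  "irreducible_character H \<chi> \<longleftrightarrow>
     (\<exists>d \<rho>. irreducible_rep H d \<rho> \<and> (\<forall>g\<in>carrier H. \<chi> g = mat_trace (\<rho> g)))"

text \<open>\<open>sym_group m\<close> permutes \<open>{1..m}\<close>, while matrix entries are indexed from \<open>0\<close>;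
  the entry \<open>x_ij\<close> of the usual notation is therefore \<open>X $$ (i - 1, j - 1)\<close>.\<close>
definition immanant ::
  "nat \<Rightarrow> (nat \<Rightarrow> nat) set \<Rightarrow> ((nat \<Rightarrow> nat) \<Rightarrow> complex) \<Rightarrow> complex mat \<Rightarrow> complex" where
  "immanant m G \<chi> X = (\<Sum>\<sigma>\<in>G. \<chi> \<sigma> * (\<Prod>i=1..m. X $$ (i - 1, \<sigma> i - 1)))"

text \<open>Here \<open>\<le>\<close> on \<^typ>\<open>complex\<close> is the order of \<^theory>\<open>HOL-Library.Complex_Order\<close>: \<open>x \<le> y\<close>
  means \<open>Re x \<le> Re y\<close> and \<open>Im x = Im y\<close>, i.e. \<open>y - x\<close> is a nonnegative real.\<close>
definition hermitian_psd :: "nat \<Rightarrow> complex mat \<Rightarrow> bool" where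
  "hermitian_psd m A \<longleftrightarrow>
     A \<in> carrier_mat m m \<and> mat_adjoint A = A \<and> (\<forall>v\<in>carrier_vec m. 0 \<le> (A *\<^sub>v v) \<bullet>c v)"

end

theory Submission
  imports Defs
begin

text \<open>Row multilinearity expands every term of the inequality into mixed immanants
  \<open>D(f) = \<Sum>\<sigma>\<in>G. \<chi>(\<sigma>) \<Prod>k. (A\<^bsub>f k\<^esub>)\<^bsub>k,\<sigma> k\<^esub>\<close>, one for each \<open>f : {1..m} \<rightarrow> {1..n}\<close>,
  where \<open>d(\<Sum>i. A\<^sub>i)\<close> collects all \<open>f\<close>, \<open>d(A\<^sub>i + A\<^sub>j)\<close> those with range inside \<open>{i, j}\<close>, and \<open>d(A\<^sub>i)\<close> the
  constant one. Counting (\<open>inclusion_exclusion_coeff\<close>) shows that the functions with at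
  most two values cancel, so that the difference of the two sides is the sum of \<open>D(f)\<close> over all \<open>f\<close>
  with at least three values.

  This set of functions is closed under composition with elements of \<open>G\<close>, hence \<open>D(f)\<close> may be replaced
  by its average over the functions \<open>f \<circ> \<tau>\<close>, \<open>\<tau> \<in> G\<close>. Up to the factor \<open>|G|\<close>, that average is
  \<open>\<Sum>a,b\<in>G. \<chi>(b a\<^sup>-\<^sup>1) \<Prod>l. (A\<^bsub>f l\<^esub>)\<^bsub>a l,b l\<^esub>\<close>,
  a sum over the entries of the Schur product of two positive semidefinite kernels on \<open>G\<close>
  (\<open>mixed_immanant_orbit_nonneg\<close>). The product over \<open>l\<close> is such a kernel because each \<open>A\<^sub>i\<close> is a Gram
  matrix (\<open>pos_kernel_gram\<close>), and \<open>\<chi>(b a\<^sup>-\<^sup>1)\<close> is one because the representation can be made unitary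
  (\<open>character_gram\<close>).\<close>

section \<open>Gram factorization of positive semidefinite kernels\<close>

definition pos_kernel :: "'a set \<Rightarrow> ('a \<Rightarrow> 'a \<Rightarrow> complex) \<Rightarrow> bool" where
  "pos_kernel S K \<longleftrightarrow> (\<forall>x\<in>S. \<forall>y\<in>S. K y x = cnj (K x y)) \<and>
     (\<forall>c. 0 \<le> (\<Sum>x\<in>S. \<Sum>y\<in>S. cnj (c x) * K x y * c y))"

lemma cnj_mult_self_nonneg: "0 \<le> cnj z * z"
  by (metis complex_norm_square less_eq_complex_def mult.commute of_real_0 Re_complex_of_real Im_complex_of_real zero_le_power2)

text \<open>Separates the contribution of one index \<open>a\<close>, with value \<open>t\<close>, from a quadratic form.
  Minimizing over \<open>t\<close> then completes the square.\<close>

lemma quadratic_form_insert: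
  fixes K :: "'a \<Rightarrow> 'a \<Rightarrow> complex"
  assumes "finite S" "a \<notin> S"
    and herm: "\<And>x y. x \<in> insert a S \<Longrightarrow> y \<in> insert a S \<Longrightarrow> K y x = cnj (K x y)"
    and L: "L = (\<Sum>y\<in>S. K a y * c y)"
  shows "(\<Sum>x\<in>insert a S. \<Sum>y\<in>insert a S. cnj ((c(a := t)) x) * K x y * (c(a := t)) y) =
    cnj t * K a a * t + cnj t * L + cnj L * t + (\<Sum>x\<in>S. \<Sum>y\<in>S. cnj (c x) * K x y * c y)"
proof -
  have upd: "(c(a := t)) x = c x" if "x \<in> S" for x using that assms(2) by auto
  have 1: "(\<Sum>y\<in>S. cnj t * K a y * (c(a := t)) y) = cnj t * L"
    unfolding L sum_distrib_left by (intro sum.cong refl) (use upd in auto)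
  have 2: "(\<Sum>x\<in>S. cnj ((c(a := t)) x) * K x a * t) = cnj L * t"
    unfolding L cnj_sum sum_distrib_right
  proof (intro sum.cong refl)
    fix x assume x: "x \<in> S"
    have "K x a = cnj (K a x)" using herm[of a x] x by blast
    then show "cnj ((c(a := t)) x) * K x a * t = cnj (K a x * c x) * t"
      using upd[OF x] by simp
  qed
  have 3: "(\<Sum>x\<in>S. \<Sum>y\<in>S. cnj ((c(a := t)) x) * K x y * (c(a := t)) y) =
      (\<Sum>x\<in>S. \<Sum>y\<in>S. cnj (c x) * K x y * c y)"
    by (intro sum.cong refl) (use upd in auto)
  have "(\<Sum>x\<in>insert a S. \<Sum>y\<in>insert a S. cnj ((c(a := t)) x) * K x y * (c(a := t)) y) =
     (cnj t * K a a * t + (\<Sum>y\<in>S. cnj t * K a y * (c(a := t)) y)) +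
     ((\<Sum>x\<in>S. cnj ((c(a := t)) x) * K x a * t) +
      (\<Sum>x\<in>S. \<Sum>y\<in>S. cnj ((c(a := t)) x) * K x y * (c(a := t)) y))"
    by (simp only: sum.insert[OF assms(1,2)] sum.distrib fun_upd_same add.assoc add.commute add.left_commute)
  then show ?thesis unfolding 1 2 3 by (simp add: algebra_simps)
qed

text \<open>Elimination of one index at a time: the column of \<open>a\<close>, divided by \<open>sqrt (K a a)\<close>,
  is one vector of the factorization, and the Schur complement of \<open>K a a\<close> is again positive
  semidefinite, because its quadratic form is the minimum of that of \<open>K\<close> over the value at \<open>a\<close>.
  If \<open>K a a = 0\<close>, then its whole row and column vanish, and division by zero yielding \<open>0\<close> makes all
  the formulas below correct in that case too.\<close>

lemma pos_kernel_gram: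
  assumes "finite S" "pos_kernel S K"
  shows "\<exists>u. \<forall>x\<in>S. \<forall>y\<in>S. K x y = (\<Sum>k\<in>S. u k x * cnj (u k y))"
  using assms
proof (induction S arbitrary: K rule: finite_induct)
  case empty
  then show ?case by simp
next
  case (insert a S)
  have herm: "K y x = cnj (K x y)" if "x \<in> insert a S" "y \<in> insert a S" for x y
    using insert.prems that unfolding pos_kernel_def by blast
  define L where "L c = (\<Sum>y\<in>S. K a y * c y)" for c
  define Q where "Q c = (\<Sum>x\<in>S. \<Sum>y\<in>S. cnj (c x) * K x y * c y)" for c
  have block: "0 \<le> cnj t * K a a * t + cnj t * L c + cnj (L c) * t + Q c" for t c
  proof -
    have "0 \<le> (\<Sum>x\<in>insert a S. \<Sum>y\<in>insert a S. cnj ((c(a := t)) x) * K x y * (c(a := t)) y)"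
      using insert.prems unfolding pos_kernel_def by blast
    also have "\<dots> = cnj t * K a a * t + cnj t * L c + cnj (L c) * t + Q c"
      unfolding Q_def by (rule quadratic_form_insert) (rule insert.hyps herm L_def | assumption)+
    finally show ?thesis .
  qed
  define \<kappa> where "\<kappa> = Re (K a a)"
  have Kaa: "K a a = of_real \<kappa>"
    using herm[of a a] unfolding \<kappa>_def by (simp add: complex_eq_iff)
  have \<kappa>_nonneg: "0 \<le> \<kappa>"
    using block[of 1 "\<lambda>_. 0"] unfolding L_def Q_def Kaa by (simp add: less_eq_complex_def)
  have row_zero: "K a x = 0" if "\<kappa> = 0" "x \<in> S" for x
  proof (rule ccontr)
    assume nz: "K a x \<noteq> 0"
    define c :: "_ \<Rightarrow> complex" where "c y = (if y = x then 1 else 0)" for y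
    \<comment> \<open>With value \<open>1\<close> at \<open>x\<close> and \<open>- s * K a x\<close> at \<open>a\<close>, the quadratic form is affine and decreasing in
    \<open>s\<close>; this \<open>s\<close> makes it equal to \<open>-1\<close>.\<close>
    define s where "s = (Re (K x x) + 1) / (2 * (cmod (K a x))\<^sup>2)"
    have delta: "(\<Sum>y\<in>S. g y * c y) = g x" for g
      unfolding c_def using that insert.hyps(1) by (simp add: if_distrib cong: if_cong)
    have Lc: "L c = K a x" unfolding L_def by (rule delta)
    have "Q c = (\<Sum>z\<in>S. cnj (c z) * K z x)" unfolding Q_def delta ..
    also have "\<dots> = (\<Sum>z\<in>S. K z x * c z)" by (intro sum.cong refl) (simp add: c_def)
    also have "\<dots> = K x x" by (rule delta)
    finally have Qc: "Q c = K x x" .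
    have sq: "K a x * cnj (K a x) = of_real ((cmod (K a x))\<^sup>2)" 
      using complex_norm_square[of "K a x"] by simp
    have "cnj (- of_real s * K a x) * L c + cnj (L c) * (- of_real s * K a x)
        = of_real (- 2 * s) * (K a x * cnj (K a x))"
      unfolding Lc by (simp add: algebra_simps)
    also have "\<dots> = of_real (- 2 * s * (cmod (K a x))\<^sup>2)" unfolding sq by simp
    also have "- 2 * s * (cmod (K a x))\<^sup>2 = - (Re (K x x) + 1)"
      unfolding s_def using nz by (simp add: field_simps)
    finally have "0 \<le> of_real (- (Re (K x x) + 1)) + K x x"
      using block[of "- of_real s * K a x" c] that(1) unfolding Qc Kaa by simp
    then show False by (simp add: less_eq_complex_def)
  qed
  define K' where "K' x y = K x y - K x a * K a y / of_real \<kappa>" for x y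
  have "pos_kernel S K'"
    unfolding pos_kernel_def
  proof (intro conjI ballI allI)
    fix x y assume "x \<in> S" "y \<in> S"
    then have "K y x = cnj (K x y)" "K y a = cnj (K a y)" "K x a = cnj (K a x)"
      using herm[of x y] herm[of a y] herm[of a x] by blast+
    then show "K' y x = cnj (K' x y)" unfolding K'_def by simp
  next
    fix c
    have "(\<Sum>x\<in>S. \<Sum>y\<in>S. cnj (c x) * K' x y * c y) =
        Q c - (\<Sum>x\<in>S. \<Sum>y\<in>S. cnj (K a x * c x) * (K a y * c y) / of_real \<kappa>)"
      unfolding Q_def K'_def sum_subtractf[symmetric]
    proof (intro sum.cong refl)
      fix x y assume "x \<in> S" "y \<in> S"
      then have "K x a = cnj (K a x)" using herm[of a x] by blast
      then show "cnj (c x) * (K x y - K x a * K a y / complex_of_real \<kappa>) * c y =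
        cnj (c x) * K x y * c y - cnj (K a x * c x) * (K a y * c y) / complex_of_real \<kappa>"
        by (simp add: algebra_simps)
    qed
    also have "(\<Sum>x\<in>S. \<Sum>y\<in>S. cnj (K a x * c x) * (K a y * c y) / of_real \<kappa>) =
        cnj (L c) * L c / of_real \<kappa>"
      unfolding L_def cnj_sum sum_product sum_divide_distrib ..
    also have "Q c - cnj (L c) * L c / of_real \<kappa> =
        cnj (- L c / of_real \<kappa>) * K a a * (- L c / of_real \<kappa>) + cnj (- L c / of_real \<kappa>) * L c +
        cnj (L c) * (- L c / of_real \<kappa>) + Q c"
      unfolding Kaa by (cases "\<kappa> = 0") (auto simp: field_simps)
    \<comment> \<open>The value \<open>- L c / \<kappa>\<close> at \<open>a\<close> is the minimizer.\<close>
    finally show "0 \<le> (\<Sum>x\<in>S. \<Sum>y\<in>S. cnj (c x) * K' x y * c y)"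
      using block[of "- L c / of_real \<kappa>" c] by simp
  qed
  then obtain u where u: "\<And>x y. x \<in> S \<Longrightarrow> y \<in> S \<Longrightarrow> K' x y = (\<Sum>k\<in>S. u k x * cnj (u k y))"
    using insert.IH by blast
  define v where "v k x = (if k = a then K x a / of_real (sqrt \<kappa>) else if x = a then 0 else u k x)" for k x
  have sqrt: "complex_of_real (sqrt \<kappa>) * complex_of_real (sqrt \<kappa>) = of_real \<kappa>"
    using \<kappa>_nonneg by (simp flip: of_real_mult)
  have "K x y = (\<Sum>k\<in>insert a S. v k x * cnj (v k y))"
    if xy: "x \<in> insert a S" "y \<in> insert a S" for x y
  proof -
    have "cnj (K y a) = K a y" using herm[of y a] xy by (metis insertI1)
    then have "v a x * cnj (v a y) = K x a * K a y / of_real \<kappa>"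
      using sqrt by (simp add: v_def)
    moreover have "(\<Sum>k\<in>S. v k x * cnj (v k y)) = (if x = a \<or> y = a then 0 else K' x y)"
    proof (cases "x = a \<or> y = a")
      case True
      then show ?thesis using insert.hyps(2) by (auto simp: v_def intro!: sum.neutral)
    next
      case False
      then have "(\<Sum>k\<in>S. v k x * cnj (v k y)) = (\<Sum>k\<in>S. u k x * cnj (u k y))"
        using insert.hyps(2) by (intro sum.cong refl) (auto simp: v_def)
      then show ?thesis using False u[of x y] xy by auto
    qed
    ultimately have *: "(\<Sum>k\<in>insert a S. v k x * cnj (v k y)) =
        K x a * K a y / of_real \<kappa> + (if x = a \<or> y = a then 0 else K' x y)"
      using insert.hyps by simp
    show ?thesis
    proof (cases "x = a \<or> y = a")
      case True
      have "K a z = 0" if "\<kappa> = 0" "z \<in> insert a S" for z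
        using row_zero[of z] that Kaa by auto
      moreover have "K z a = 0" if "\<kappa> = 0" "z \<in> insert a S" for z
        using calculation[OF that] herm[of a z] that(2) by force
      ultimately show ?thesis using True Kaa xy unfolding * by (cases "\<kappa> = 0") auto
    next
      case False
      then show ?thesis unfolding * K'_def by simp
    qed
  qed
  then show ?case by blast
qed

lemma pos_kernel_hermitian_psd:
  assumes "hermitian_psd m A"
  shows "pos_kernel {..<m} (\<lambda>i j. A $$ (i, j))"
  unfolding pos_kernel_def
proof (intro conjI ballI allI)
  have A: "A \<in> carrier_mat m m" and adj: "mat_adjoint A = A"
    and pos: "\<And>v. v \<in> carrier_vec m \<Longrightarrow> 0 \<le> (A *\<^sub>v v) \<bullet>c v"
    using assms unfolding hermitian_psd_def by auto
  {
    fix x y assume "x \<in> {..<m}" "y \<in> {..<m}"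
    then have "mat_adjoint A $$ (y, x) = cnj (A $$ (x, y))"
      using A unfolding mat_adjoint_def by (simp add: mat_of_rows_index)
    then show "A $$ (y, x) = cnj (A $$ (x, y))" unfolding adj .
  next
    fix c :: "nat \<Rightarrow> complex"
    have "(A *\<^sub>v vec m c) \<bullet>c vec m c = (\<Sum>x<m. (\<Sum>y<m. A $$ (x, y) * c y) * cnj (c x))"
      using A unfolding scalar_prod_def
      by (auto simp: scalar_prod_def lessThan_atLeast0 intro!: sum.cong)
    also have "\<dots> = (\<Sum>x<m. \<Sum>y<m. cnj (c x) * A $$ (x, y) * c y)"
      unfolding sum_distrib_right by (intro sum.cong refl) (simp add: algebra_simps)
    finally show "0 \<le> (\<Sum>x<m. \<Sum>y<m. cnj (c x) * A $$ (x, y) * c y)"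
      using pos[of "vec m c"] by simp
  }
qed

section \<open>Sums, adjoints and traces of matrices\<close>

lemma index_finsum_mat:
  fixes A :: "'b \<Rightarrow> 'a :: comm_ring_1 mat"
  assumes "finite S" "\<And>s. s \<in> S \<Longrightarrow> A s \<in> carrier_mat nr nc" "i < nr" "j < nc"
  shows "finsum (module_mat TYPE('a) nr nc) A S $$ (i, j) = (\<Sum>s\<in>S. A s $$ (i, j))"
proof -
  let ?M = "module_mat TYPE('a) nr nc"
  interpret M: abelian_group ?M by (rule abelian_group_mat)
  show ?thesis using assms(1,2)
  proof (induction S rule: finite_induct)
    case empty
    then show ?case using assms(3,4) M.finsum_empty by (simp add: module_mat_simps)
  next
    case (insert s S)
    have A: "A \<in> S \<rightarrow> carrier ?M" "A s \<in> carrier ?M"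
      using insert.prems by (auto simp: module_mat_simps)
    have "finsum ?M A (insert s S) = A s + finsum ?M A S"
      using M.finsum_insert[OF insert.hyps A] by (simp add: module_mat_simps)
    moreover have "finsum ?M A S \<in> carrier_mat nr nc"
      using M.finsum_closed[OF A(1)] by (simp add: module_mat_simps)
    ultimately show ?case using insert assms(3,4) by auto
  qed
qed

lemma mat_adjoint_carrier: "A \<in> carrier_mat n m \<Longrightarrow> mat_adjoint A \<in> carrier_mat m n"
  unfolding mat_adjoint_def by auto

lemma mat_adjoint_index:
  assumes "A \<in> carrier_mat n m" "i < m" "j < n"
  shows "mat_adjoint A $$ (i, j) = conjugate (A $$ (j, i))"
  using assms unfolding mat_adjoint_def by (simp add: mat_of_rows_index)

lemma times_mat_index_sum:
  assumes "A \<in> carrier_mat n k" "B \<in> carrier_mat k m" "i < n" "j < m"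
  shows "(A * B) $$ (i, j) = (\<Sum>l<k. A $$ (i, l) * B $$ (l, j))"
  using assms by (auto simp: scalar_prod_def lessThan_atLeast0)

lemma mat_adjoint_times:
  fixes A B :: "complex mat"
  assumes A: "A \<in> carrier_mat n k" and B: "B \<in> carrier_mat k m"
  shows "mat_adjoint (A * B) = mat_adjoint B * mat_adjoint A"
proof (rule eq_matI)
  note c = mat_adjoint_carrier[OF A] mat_adjoint_carrier[OF B] mat_adjoint_carrier[OF mult_carrier_mat[OF A B]]
  then show "dim_row (mat_adjoint (A * B)) = dim_row (mat_adjoint B * mat_adjoint A)"
    "dim_col (mat_adjoint (A * B)) = dim_col (mat_adjoint B * mat_adjoint A)"
    by auto
  fix i j assume "i < dim_row (mat_adjoint B * mat_adjoint A)" "j < dim_col (mat_adjoint B * mat_adjoint A)"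
  then have ij: "i < m" "j < n" using c by auto
  have "mat_adjoint (A * B) $$ (i, j) = (\<Sum>l<k. cnj (A $$ (j, l)) * cnj (B $$ (l, i)))"
    using ij by (simp add: mat_adjoint_index[OF mult_carrier_mat[OF A B]] times_mat_index_sum[OF A B])
  also have "\<dots> = (mat_adjoint B * mat_adjoint A) $$ (i, j)"
    unfolding times_mat_index_sum[OF c(2,1) ij]
    by (intro sum.cong refl)
       (use ij in \<open>simp add: mat_adjoint_index[OF A] mat_adjoint_index[OF B] mult.commute\<close>)
  finally show "mat_adjoint (A * B) $$ (i, j) = (mat_adjoint B * mat_adjoint A) $$ (i, j)" .
qed

lemma mat_trace_comm:
  assumes A: "A \<in> carrier_mat n m" and B: "B \<in> carrier_mat m n"
  shows "mat_trace (A * B) = mat_trace (B * A)"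
proof -
  have "mat_trace (A * B) = (\<Sum>i<n. \<Sum>l<m. A $$ (i, l) * B $$ (l, i))"
    using A B unfolding mat_trace_def by (intro sum.cong) (auto simp: scalar_prod_def lessThan_atLeast0)
  also have "\<dots> = (\<Sum>l<m. \<Sum>i<n. B $$ (l, i) * A $$ (i, l))"
    by (subst sum.swap) (simp add: mult.commute)
  also have "\<dots> = mat_trace (B * A)"
    using A B unfolding mat_trace_def by (intro sum.cong) (auto simp: scalar_prod_def lessThan_atLeast0)
  finally show ?thesis .
qed

section \<open>Characters as Gram kernels\<close>

lemma matrix_rep_facts:
  assumes "group H" "matrix_rep H d \<rho>"
  shows "\<And>g. g \<in> carrier H \<Longrightarrow> \<rho> g \<in> carrier_mat d d"
    and "\<And>g h. g \<in> carrier H \<Longrightarrow> h \<in> carrier H \<Longrightarrow> \<rho> (g \<otimes>\<^bsub>H\<^esub> h) = \<rho> g * \<rho> h"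
    and "\<rho> \<one>\<^bsub>H\<^esub> = 1\<^sub>m d"
proof -
  let ?R = "ring_mat TYPE(complex) d ()"
  interpret R: ring ?R by (rule ring_mat)
  have hom: "\<rho> \<in> hom H (units_of ?R)" using assms(2) unfolding matrix_rep_def .
  show "\<rho> g \<in> carrier_mat d d" if "g \<in> carrier H" for g
    using hom_in_carrier[OF hom that] by (auto simp: units_of_def Units_def ring_mat_def)
  show "\<rho> (g \<otimes>\<^bsub>H\<^esub> h) = \<rho> g * \<rho> h" if "g \<in> carrier H" "h \<in> carrier H" for g h
    using hom_mult[OF hom that] by (simp add: units_of_def ring_mat_def)
  show "\<rho> \<one>\<^bsub>H\<^esub> = 1\<^sub>m d"
    using hom_one[OF hom assms(1) R.units_group] by (simp add: units_of_def ring_mat_def)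
qed

text \<open>The unitarian trick: averaging the standard inner product over the group gives the
  invariant form \<open>K = \<Sum>g. \<rho>(g)\<^sup>* \<rho>(g)\<close>.
  Its Gram factorization \<open>K = V\<^sup>* V\<close> supplies the change of basis \<open>V\<close>, which is invertible since
  the summand of the identity element already makes \<open>K\<close> positive definite.\<close>

lemma invariant_inner_product:
  fixes H (structure)
  assumes H: "group H" "finite (carrier H)" and rep: "matrix_rep H d \<rho>"
  obtains V where "V \<in> carrier_mat d d" "det V \<noteq> 0"
    "\<And>g. g \<in> carrier H \<Longrightarrow> mat_adjoint (V * \<rho> g) * (V * \<rho> g) = mat_adjoint V * V"
proof -
  interpret group H by fact
  note \<rho> = matrix_rep_facts[OF H(1) rep]
  define K where "K i j = (\<Sum>g\<in>carrier H. \<Sum>k<d. cnj (\<rho> g $$ (k, i)) * \<rho> g $$ (k, j))" for i j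
  \<comment> \<open>The first argument is kept independent of the second: with columns of \<open>\<rho> h\<close> as
    arguments, the same formula yields the invariance of \<open>K\<close>.\<close>
  have K_form: "(\<Sum>i<d. \<Sum>j<d. cnj (b i) * K i j * c j) =
      (\<Sum>g\<in>carrier H. \<Sum>k<d. cnj (\<Sum>i<d. \<rho> g $$ (k, i) * b i) * (\<Sum>j<d. \<rho> g $$ (k, j) * c j))" for b c
  proof -
    have "(\<Sum>i<d. \<Sum>j<d. cnj (b i) * K i j * c j) =
       (\<Sum>i<d. \<Sum>j<d. \<Sum>g\<in>carrier H. \<Sum>k<d. cnj (\<rho> g $$ (k, i) * b i) * (\<rho> g $$ (k, j) * c j))"
      unfolding K_def sum_distrib_left sum_distrib_right
      by (intro sum.cong refl) (simp add: algebra_simps)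
    also have "\<dots> = (\<Sum>i<d. \<Sum>g\<in>carrier H. \<Sum>k<d. \<Sum>j<d. cnj (\<rho> g $$ (k, i) * b i) * (\<rho> g $$ (k, j) * c j))"
      by (subst sum.swap, subst (2) sum.swap) simp
    also have "\<dots> = (\<Sum>g\<in>carrier H. \<Sum>k<d. \<Sum>i<d. \<Sum>j<d. cnj (\<rho> g $$ (k, i) * b i) * (\<rho> g $$ (k, j) * c j))"
      by (subst sum.swap, subst (2) sum.swap) simp
    finally show ?thesis unfolding cnj_sum sum_product .
  qed
  have "pos_kernel {..<d} K"
    unfolding pos_kernel_def
  proof (intro conjI ballI allI)
    show "K j i = cnj (K i j)" for i j unfolding K_def by (simp add: mult.commute)
    show "0 \<le> (\<Sum>i<d. \<Sum>j<d. cnj (c i) * K i j * c j)" for c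
      unfolding K_form by (intro sum_nonneg cnj_mult_self_nonneg)
  qed
  then obtain u where u: "\<And>i j. i < d \<Longrightarrow> j < d \<Longrightarrow> K i j = (\<Sum>k<d. u k i * cnj (u k j))"
    using pos_kernel_gram[of "{..<d}" K] by auto
  define V where "V = mat d d (\<lambda>(k, j). cnj (u k j))"
  have V: "V \<in> carrier_mat d d" unfolding V_def by simp
  have V_index: "V $$ (k, j) = cnj (u k j)" if "k < d" "j < d" for k j
    unfolding V_def using that by simp
  have K_VV: "(mat_adjoint V * V) $$ (i, j) = K i j" if "i < d" "j < d" for i j
    unfolding u[OF that] times_mat_index_sum[OF mat_adjoint_carrier[OF V] V that]
    by (intro sum.cong refl) (use that in \<open>simp add: mat_adjoint_index[OF V] V_index\<close>)
  have inv: "mat_adjoint (V * \<rho> h) * (V * \<rho> h) = mat_adjoint V * V" if h: "h \<in> carrier H" for h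
  proof -
    have "mat_adjoint (V * \<rho> h) * (V * \<rho> h) = mat_adjoint (\<rho> h) * (mat_adjoint V * V) * \<rho> h"
      unfolding mat_adjoint_times[OF V \<rho>(1)[OF h]]
      using V \<rho>(1)[OF h] mat_adjoint_carrier[OF V] mat_adjoint_carrier[OF \<rho>(1)[OF h]]
      by (simp add: assoc_mult_mat[of _ d d _ d _ d])
    also have "\<dots> = mat_adjoint V * V"
    proof (rule eq_matI)
      note c = \<rho>(1)[OF h] mat_adjoint_carrier[OF \<rho>(1)[OF h]] V mat_adjoint_carrier[OF V]
      show "dim_row (mat_adjoint (\<rho> h) * (mat_adjoint V * V) * \<rho> h) = dim_row (mat_adjoint V * V)"
        "dim_col (mat_adjoint (\<rho> h) * (mat_adjoint V * V) * \<rho> h) = dim_col (mat_adjoint V * V)"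
        using c by auto
      fix i j assume "i < dim_row (mat_adjoint V * V)" "j < dim_col (mat_adjoint V * V)"
      then have ij: "i < d" "j < d" using c by auto
      have "(mat_adjoint (\<rho> h) * (mat_adjoint V * V) * \<rho> h) $$ (i, j) =
          (\<Sum>b<d. \<Sum>a<d. cnj (\<rho> h $$ (a, i)) * K a b * \<rho> h $$ (b, j))"
        using ij K_VV
        by (simp add: times_mat_index_sum[OF mult_carrier_mat[OF c(2) mult_carrier_mat[OF c(4,3)]] c(1)]
            times_mat_index_sum[OF c(2) mult_carrier_mat[OF c(4,3)]] mat_adjoint_index[OF c(1)]
            sum_distrib_right del: index_mult_mat)
      also have "\<dots> = (\<Sum>a<d. \<Sum>b<d. cnj (\<rho> h $$ (a, i)) * K a b * \<rho> h $$ (b, j))"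
        by (rule sum.swap)
      also have "\<dots> = (\<Sum>g\<in>carrier H. \<Sum>k<d. cnj (\<rho> (g \<otimes> h) $$ (k, i)) * \<rho> (g \<otimes> h) $$ (k, j))"
        unfolding K_form
        by (intro sum.cong refl)
           (use ij in \<open>simp add: \<rho>(2)[OF _ h] times_mat_index_sum[OF \<rho>(1) \<rho>(1)[OF h]] del: index_mult_mat\<close>)
      also have "\<dots> = K i j"
        unfolding K_def
        by (rule sum.reindex_bij_witness[where i = "\<lambda>g. g \<otimes> inv h" and j = "\<lambda>g. g \<otimes> h"])
           (use h in \<open>auto simp: m_assoc\<close>)
      finally show "(mat_adjoint (\<rho> h) * (mat_adjoint V * V) * \<rho> h) $$ (i, j) = (mat_adjoint V * V) $$ (i, j)"
        using K_VV ij by simp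
    qed
    finally show ?thesis .
  qed
  have "det V \<noteq> 0"
  proof
    assume "det V = 0"
    then obtain v where v: "v \<in> carrier_vec d" "v \<noteq> 0\<^sub>v d" "V *\<^sub>v v = 0\<^sub>v d"
      using det_0_iff_vec_prod_zero_field[OF V] by auto
    have Vv: "(\<Sum>j<d. V $$ (k, j) * v $ j) = 0" if "k < d" for k
    proof -
      have "(V *\<^sub>v v) $ k = (\<Sum>j<d. V $$ (k, j) * v $ j)"
        using V v(1) that by (auto simp: scalar_prod_def lessThan_atLeast0)
      then show ?thesis using that v(3) by simp
    qed
    have "(\<Sum>i<d. \<Sum>j<d. cnj (v $ i) * K i j * v $ j) = 0"
    proof (rule sum.neutral, rule ballI)
      fix i assume i: "i \<in> {..<d}"
      have "(\<Sum>j<d. cnj (v $ i) * K i j * v $ j) =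
          (\<Sum>j<d. \<Sum>k<d. cnj (v $ i) * u k i * (V $$ (k, j) * v $ j))"
        using i by (auto intro!: sum.cong simp: u V_def sum_distrib_left sum_distrib_right algebra_simps)
      also have "\<dots> = (\<Sum>k<d. cnj (v $ i) * u k i * (\<Sum>j<d. V $$ (k, j) * v $ j))"
        by (subst sum.swap) (simp add: sum_distrib_left)
      finally show "(\<Sum>j<d. cnj (v $ i) * K i j * v $ j) = 0" using Vv by simp
    qed
    then have "(\<Sum>g\<in>carrier H. \<Sum>k<d. cnj (\<Sum>j<d. \<rho> g $$ (k, j) * v $ j) * (\<Sum>j<d. \<rho> g $$ (k, j) * v $ j)) = 0"
      (is "sum ?N _ = 0") unfolding K_form .
    moreover have "0 \<le> ?N g" for g by (intro sum_nonneg cnj_mult_self_nonneg)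
    ultimately have z: "?N \<one> = 0"
      using sum_nonneg_eq_0_iff[OF H(2), of ?N] one_closed by blast
    have one: "(\<Sum>j<d. \<rho> \<one> $$ (k, j) * v $ j) = v $ k" if "k < d" for k
    proof -
      have "(\<Sum>j<d. \<rho> \<one> $$ (k, j) * v $ j) = (\<Sum>j<d. if j = k then v $ k else 0)"
        unfolding \<rho>(3) using that by (intro sum.cong) auto
      then show ?thesis using that by simp
    qed
    have "v $ k = 0" if "k < d" for k
    proof -
      have "(\<Sum>k<d. cnj (v $ k) * v $ k) = 0" using z one by simp
      then show ?thesis
        using that by (subst (asm) sum_nonneg_eq_0_iff) (auto intro: cnj_mult_self_nonneg)
    qed
    then show False using v(1,2) by (metis eq_vecI carrier_vecD index_zero_vec)
  qed
  then show ?thesis using that V inv by blast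
qed

text \<open>In a basis in which the representation is unitary, \<open>\<rho>(b a\<^sup>-\<^sup>1) = \<rho>(b) \<rho>(a)\<^sup>*\<close>, whose trace
  is the sum over all entries of \<open>\<rho>(b)\<close> times the conjugate entry of \<open>\<rho>(a)\<close>. Thus a character is a
  positive definite function on the group.\<close>

lemma character_gram:
  fixes H (structure)
  assumes H: "group H" "finite (carrier H)" and rep: "matrix_rep H d \<rho>"
  obtains r :: "nat \<times> nat \<Rightarrow> 'a \<Rightarrow> complex"
  where "\<And>a b. a \<in> carrier H \<Longrightarrow> b \<in> carrier H \<Longrightarrow>
    mat_trace (\<rho> (b \<otimes> inv a)) = (\<Sum>p\<in>{..<d} \<times> {..<d}. r p b * cnj (r p a))"
proof -
  interpret group H by fact
  note \<rho> = matrix_rep_facts[OF H(1) rep]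
  obtain V where V: "V \<in> carrier_mat d d" "det V \<noteq> 0"
    and inv: "\<And>g. g \<in> carrier H \<Longrightarrow> mat_adjoint (V * \<rho> g) * (V * \<rho> g) = mat_adjoint V * V"
    using invariant_inner_product[OF H rep] by blast
  obtain W where W: "W \<in> carrier_mat d d" and VW: "V * W = 1\<^sub>m d" and WV: "W * V = 1\<^sub>m d"
    using det_non_zero_imp_unit[OF V, of "()"] by (auto simp: Units_def ring_mat_def)
  define U where "U g = V * \<rho> g * W" for g
  have U: "U g \<in> carrier_mat d d" if "g \<in> carrier H" for g
    unfolding U_def using V(1) W \<rho>(1)[OF that] by auto
  have U_mult: "U (g \<otimes> h) = U g * U h" if gh: "g \<in> carrier H" "h \<in> carrier H" for g h
  proof -
    have "U g * U h = V * \<rho> g * (W * V) * \<rho> h * W"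
      unfolding U_def using V(1) W \<rho>(1)[OF gh(1)] \<rho>(1)[OF gh(2)]
      by (simp add: assoc_mult_mat[of _ d d _ d _ d])
    then show ?thesis unfolding WV U_def \<rho>(2)[OF gh]
      using V(1) W \<rho>(1)[OF gh(1)] \<rho>(1)[OF gh(2)] by (simp add: assoc_mult_mat[of _ d d _ d _ d])
  qed
  have U_one: "U \<one> = 1\<^sub>m d" unfolding U_def \<rho>(3) using V(1) VW by simp
  have U_unitary: "mat_adjoint (U g) * U g = 1\<^sub>m d" if g: "g \<in> carrier H" for g
  proof -
    have VR: "V * \<rho> g \<in> carrier_mat d d" using V(1) \<rho>(1)[OF g] by auto
    note c = V(1) W VR mat_adjoint_carrier[OF V(1)] mat_adjoint_carrier[OF W] mat_adjoint_carrier[OF VR]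
    have "mat_adjoint (U g) * U g = mat_adjoint W * (mat_adjoint (V * \<rho> g) * (V * \<rho> g)) * W"
      unfolding U_def mat_adjoint_times[OF VR W] using c
      by (simp add: assoc_mult_mat[of _ d d _ d _ d])
    also have "\<dots> = (mat_adjoint W * mat_adjoint V) * (V * W)"
      unfolding inv[OF g] using c by (simp add: assoc_mult_mat[of _ d d _ d _ d])
    also have "mat_adjoint W * mat_adjoint V = mat_adjoint (1\<^sub>m d)"
      unfolding mat_adjoint_times[OF V(1) W, symmetric] VW ..
    also have "mat_adjoint (1\<^sub>m d) = (1\<^sub>m d :: complex mat)"
      by (rule eq_matI) (simp_all add: mat_adjoint_index[OF one_carrier_mat] mat_adjoint_carrier carrier_matD[OF mat_adjoint_carrier[OF one_carrier_mat]])
    finally show ?thesis using VW by simp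
  qed
  have U_inv: "U (inv g) = mat_adjoint (U g)" if g: "g \<in> carrier H" for g
  proof -
    note c = U[OF g] U[OF inv_closed[OF g]] mat_adjoint_carrier[OF U[OF g]]
    have "U g * U (inv g) = 1\<^sub>m d" using g U_mult[of g "inv g"] U_one by simp
    then have "mat_adjoint (U g) = mat_adjoint (U g) * (U g * U (inv g))"
      using c by simp
    also have "\<dots> = mat_adjoint (U g) * U g * U (inv g)"
      using c by (simp add: assoc_mult_mat[of _ d d _ d _ d])
    finally show ?thesis using c U_unitary[OF g] by simp
  qed
  have trace_U: "mat_trace (\<rho> g) = mat_trace (U g)" if g: "g \<in> carrier H" for g
  proof -
    have "mat_trace (U g) = mat_trace (W * (V * \<rho> g))"
      unfolding U_def using V(1) W \<rho>(1)[OF g] by (intro mat_trace_comm) auto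
    also have "W * (V * \<rho> g) = \<rho> g"
      using V(1) W \<rho>(1)[OF g] WV by (simp flip: assoc_mult_mat[of _ d d _ d _ d])
    finally show ?thesis ..
  qed
  show ?thesis
  proof (rule that)
    fix a b assume ab: "a \<in> carrier H" "b \<in> carrier H"
    have "mat_trace (\<rho> (b \<otimes> inv a)) = mat_trace (U b * mat_adjoint (U a))"
      using ab trace_U[of "b \<otimes> inv a"] U_mult[of b "inv a"] U_inv[of a] by simp
    also have "\<dots> = (\<Sum>i<d. \<Sum>j<d. U b $$ (i, j) * cnj (U a $$ (i, j)))"
      unfolding mat_trace_def
      using U[OF ab(1)] U[OF ab(2)] mat_adjoint_carrier[OF U[OF ab(1)]]
      by (intro sum.cong)
         (auto simp: times_mat_index_sum[of _ d d _ d] mat_adjoint_index[of _ d d] simp del: index_mult_mat(1)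
            intro!: sum.cong)
    finally show "mat_trace (\<rho> (b \<otimes> inv a)) =
        (\<Sum>p\<in>{..<d} \<times> {..<d}. U b $$ p * cnj (U a $$ p))"
      by (simp add: sum.cartesian_product)
  qed
qed

section \<open>Mixed immanants\<close>

text \<open>The term of the row expansion of \<open>d(\<Sum>s. A\<^sub>s)\<close> in which row \<open>k\<close> is taken from \<open>A (f k)\<close>.\<close>

definition mixed_immanant ::
  "nat \<Rightarrow> (nat \<Rightarrow> nat) set \<Rightarrow> ((nat \<Rightarrow> nat) \<Rightarrow> complex) \<Rightarrow> (nat \<Rightarrow> complex mat) \<Rightarrow> (nat \<Rightarrow> nat) \<Rightarrow> complex" where
  "mixed_immanant m G \<chi> A f = (\<Sum>\<sigma>\<in>G. \<chi> \<sigma> * (\<Prod>k=1..m. A (f k) $$ (k - 1, \<sigma> k - 1)))"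

text \<open>An immanant is multilinear in the rows. Only the entries of \<open>X\<close> matter, so that the
  same expansion serves for finite sums in the module of matrices and for \<open>A i + A j\<close>.\<close>

lemma immanant_sum_expand:
  assumes G: "\<And>\<sigma>. \<sigma> \<in> G \<Longrightarrow> \<sigma> permutes {1..m}" and S: "finite S"
    and X: "\<And>i j. i < m \<Longrightarrow> j < m \<Longrightarrow> X $$ (i, j) = (\<Sum>s\<in>S. A s $$ (i, j))"
  shows "immanant m G \<chi> X = (\<Sum>f\<in>{1..m} \<rightarrow>\<^sub>E S. mixed_immanant m G \<chi> A f)"
proof -
  have "(\<Prod>k=1..m. X $$ (k - 1, \<sigma> k - 1)) =
      (\<Sum>f\<in>{1..m} \<rightarrow>\<^sub>E S. \<Prod>k=1..m. A (f k) $$ (k - 1, \<sigma> k - 1))" if "\<sigma> \<in> G" for \<sigma>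
  proof -
    have "X $$ (k - 1, \<sigma> k - 1) = (\<Sum>s\<in>S. A s $$ (k - 1, \<sigma> k - 1))" if "k \<in> {1..m}" for k
      using that permutes_in_image[OF G[OF \<open>\<sigma> \<in> G\<close>], of k] by (intro X) auto
    then show ?thesis using S by (simp add: prod_sum_PiE)
  qed
  then have "immanant m G \<chi> X =
      (\<Sum>\<sigma>\<in>G. \<Sum>f\<in>{1..m} \<rightarrow>\<^sub>E S. \<chi> \<sigma> * (\<Prod>k=1..m. A (f k) $$ (k - 1, \<sigma> k - 1)))"
    unfolding immanant_def by (simp add: sum_distrib_left)
  then show ?thesis unfolding mixed_immanant_def by (simp add: sum.swap[of _ _ G])
qed

text \<open>The sum of the entries of the Schur product of two positive semidefinite kernels: each pair of
  rank-one summands contributes the squared modulus of \<open>\<Sum>a. r\<^sub>p(a) cnj (w\<^sub>q(a))\<close>.\<close>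

lemma gram_pairing_nonneg:
  fixes r :: "'p \<Rightarrow> 'a \<Rightarrow> complex" and w :: "'q \<Rightarrow> 'a \<Rightarrow> complex"
  shows "0 \<le> (\<Sum>a\<in>G. \<Sum>b\<in>G. (\<Sum>p\<in>P. r p b * cnj (r p a)) * (\<Sum>q\<in>Q. w q a * cnj (w q b)))"
proof -
  have "(\<Sum>a\<in>G. \<Sum>b\<in>G. (\<Sum>p\<in>P. r p b * cnj (r p a)) * (\<Sum>q\<in>Q. w q a * cnj (w q b))) =
      (\<Sum>a\<in>G. \<Sum>b\<in>G. \<Sum>p\<in>P. \<Sum>q\<in>Q. cnj (r p a * cnj (w q a)) * (r p b * cnj (w q b)))"
    unfolding sum_product by (intro sum.cong refl) (simp add: algebra_simps)
  also have "\<dots> = (\<Sum>a\<in>G. \<Sum>p\<in>P. \<Sum>q\<in>Q. \<Sum>b\<in>G. cnj (r p a * cnj (w q a)) * (r p b * cnj (w q b)))"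
    by (subst sum.swap, subst (2) sum.swap) simp
  also have "\<dots> = (\<Sum>p\<in>P. \<Sum>q\<in>Q. \<Sum>a\<in>G. \<Sum>b\<in>G. cnj (r p a * cnj (w q a)) * (r p b * cnj (w q b)))"
    by (subst sum.swap, subst (2) sum.swap) simp
  also have "\<dots> = (\<Sum>p\<in>P. \<Sum>q\<in>Q. cnj (\<Sum>a\<in>G. r p a * cnj (w q a)) * (\<Sum>b\<in>G. r p b * cnj (w q b)))"
    unfolding sum_product cnj_sum ..
  finally show ?thesis by (simp add: sum_nonneg cnj_mult_self_nonneg del: cnj_sum complex_cnj_mult)
qed

text \<open>Translates the group structure of \<open>sym_group m\<close> into compositions and inverses of functions.\<close>

lemma sym_subgroup_facts:
  assumes "subgroup G (sym_group m)"
  shows "\<And>\<sigma>. \<sigma> \<in> G \<Longrightarrow> \<sigma> permutes {1..m}"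
    and "finite G" and "id \<in> G"
    and "\<And>\<sigma> \<tau>. \<sigma> \<in> G \<Longrightarrow> \<tau> \<in> G \<Longrightarrow> \<sigma> \<circ> \<tau> \<in> G"
    and "\<And>\<sigma>. \<sigma> \<in> G \<Longrightarrow> inv' \<sigma> \<in> G"
    and "group (sym_group m\<lparr>carrier := G\<rparr>)"
    and "\<And>\<sigma>. \<sigma> \<in> G \<Longrightarrow> inv\<^bsub>sym_group m\<lparr>carrier := G\<rparr>\<^esub> \<sigma> = inv' \<sigma>"
proof -
  interpret S: group "sym_group m" by (rule sym_group_is_group)
  interpret G: subgroup G "sym_group m" by fact
  show perm: "\<sigma> permutes {1..m}" if "\<sigma> \<in> G" for \<sigma>
    using G.subset that sym_group_carrier by blast
  show "finite G"
    by (rule finite_subset[OF _ finite_permutations[of "{1..m}"]]) (use perm in auto)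
  show "id \<in> G" using G.one_closed by (simp add: sym_group_one)
  show "\<sigma> \<circ> \<tau> \<in> G" if "\<sigma> \<in> G" "\<tau> \<in> G" for \<sigma> \<tau>
    using G.m_closed[OF that] by (simp add: sym_group_mult)
  have inv_eq: "inv\<^bsub>sym_group m\<^esub> \<sigma> = inv' \<sigma>" if "\<sigma> \<in> G" for \<sigma>
  proof (rule S.inv_equality)
    show "inv' \<sigma> \<otimes>\<^bsub>sym_group m\<^esub> \<sigma> = \<one>\<^bsub>sym_group m\<^esub>"
      using permutes_inv_o(2)[OF perm[OF that]] by (simp add: sym_group_mult sym_group_one)
    show "\<sigma> \<in> carrier (sym_group m)" "inv' \<sigma> \<in> carrier (sym_group m)"
      using perm[OF that] permutes_inv by (auto simp: sym_group_carrier)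
  qed
  show "inv' \<sigma> \<in> G" if "\<sigma> \<in> G" for \<sigma>
    using G.m_inv_closed[OF that] inv_eq[OF that] by simp
  show "group (sym_group m\<lparr>carrier := G\<rparr>)"
    by (rule S.subgroup_imp_group[OF assms])
  show "inv\<^bsub>sym_group m\<lparr>carrier := G\<rparr>\<^esub> \<sigma> = inv' \<sigma>" if "\<sigma> \<in> G" for \<sigma>
    using S.m_inv_consistent[OF assms that] inv_eq[OF that] by simp
qed

text \<open>Substituting \<open>k = \<tau>\<^sup>-\<^sup>1 l\<close> in the products and putting \<open>a = \<tau>\<^sup>-\<^sup>1\<close>, \<open>b = \<sigma> \<tau>\<^sup>-\<^sup>1\<close> moves
  the permutation from \<open>f\<close> to the indices of the entries. The result pairs the kernel
  \<open>\<chi>(b a\<^sup>-\<^sup>1)\<close> with the restriction to \<open>G\<close> of the tensor product of the matrices \<open>A (f l)\<close>.\<close>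

lemma mixed_immanant_orbit_sum:
  assumes sub: "subgroup G (sym_group m)"
  shows "(\<Sum>\<tau>\<in>G. mixed_immanant m G \<chi> A (f \<circ> \<tau>)) =
    (\<Sum>a\<in>G. \<Sum>b\<in>G. \<chi> (b \<circ> inv' a) * (\<Prod>l=1..m. A (f l) $$ (a l - 1, b l - 1)))"
proof -
  note G = sym_subgroup_facts[OF sub]
  have shift: "(\<Prod>k=1..m. A (f (\<tau> k)) $$ (k - 1, \<sigma> k - 1)) =
      (\<Prod>l=1..m. A (f l) $$ (inv' \<tau> l - 1, (\<sigma> \<circ> inv' \<tau>) l - 1))" if "\<tau> \<in> G" for \<sigma> \<tau>
    using prod.permute[OF permutes_inv[OF G(1)[OF that]],
        of "\<lambda>k. A (f (\<tau> k)) $$ (k - 1, \<sigma> k - 1)"]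
      permutes_inverses(1)[OF G(1)[OF that]] by (simp add: o_def)
  have "(\<Sum>\<tau>\<in>G. mixed_immanant m G \<chi> A (f \<circ> \<tau>)) =
      (\<Sum>\<tau>\<in>G. \<Sum>b\<in>G. \<chi> (b \<circ> \<tau>) * (\<Prod>l=1..m. A (f l) $$ (inv' \<tau> l - 1, b l - 1)))"
  proof (rule sum.cong[OF refl])
    fix \<tau> assume \<tau>: "\<tau> \<in> G"
    have "mixed_immanant m G \<chi> A (f \<circ> \<tau>) =
        (\<Sum>\<sigma>\<in>G. \<chi> \<sigma> * (\<Prod>l=1..m. A (f l) $$ (inv' \<tau> l - 1, (\<sigma> \<circ> inv' \<tau>) l - 1)))"
      unfolding mixed_immanant_def using shift[OF \<tau>] by simp
    also have "\<dots> = (\<Sum>b\<in>G. \<chi> (b \<circ> \<tau>) * (\<Prod>l=1..m. A (f l) $$ (inv' \<tau> l - 1, b l - 1)))"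
      by (rule sum.reindex_bij_witness[where i = "\<lambda>b. b \<circ> \<tau>" and j = "\<lambda>\<sigma>. \<sigma> \<circ> inv' \<tau>"])
         (use G(4,5) \<tau> permutes_inv_o[OF G(1)[OF \<tau>]] in \<open>auto simp: comp_assoc\<close>)
    finally show "mixed_immanant m G \<chi> A (f \<circ> \<tau>) = \<dots>" .
  qed
  also have "\<dots> = (\<Sum>a\<in>G. \<Sum>b\<in>G. \<chi> (b \<circ> inv' a) * (\<Prod>l=1..m. A (f l) $$ (a l - 1, b l - 1)))"
    by (rule sum.reindex_bij_witness[where i = inv' and j = inv'])
       (use G(5) in \<open>auto simp: permutes_inv_inv[OF G(1)]\<close>)
  finally show ?thesis .
qed

text \<open>Both kernels in the orbit sum have Gram factorizations: the character by unitarity, the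
  tensor product by multiplying out the factorizations of the individual matrices. A single mixed
  immanant need not be nonnegative; only the average over \<open>G\<close> has this form.\<close>

lemma mixed_immanant_orbit_nonneg:
  assumes sub: "subgroup G (sym_group m)"
    and rep: "matrix_rep (sym_group m\<lparr>carrier := G\<rparr>) d \<rho>"
    and \<chi>: "\<And>g. g \<in> G \<Longrightarrow> \<chi> g = mat_trace (\<rho> g)"
    and psd: "\<And>k. k \<in> {1..m} \<Longrightarrow> hermitian_psd m (A (f k))"
  shows "0 \<le> (\<Sum>\<tau>\<in>G. mixed_immanant m G \<chi> A (f \<circ> \<tau>))"
proof -
  note G = sym_subgroup_facts[OF sub]
  let ?H = "sym_group m\<lparr>carrier := G\<rparr>"
  obtain r :: "nat \<times> nat \<Rightarrow> (nat \<Rightarrow> nat) \<Rightarrow> complex" where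
    "\<And>a b. a \<in> carrier ?H \<Longrightarrow> b \<in> carrier ?H \<Longrightarrow>
      mat_trace (\<rho> (b \<otimes>\<^bsub>?H\<^esub> inv\<^bsub>?H\<^esub> a)) = (\<Sum>p\<in>{..<d} \<times> {..<d}. r p b * cnj (r p a))"
    using character_gram[OF G(6) _ rep] G(2) by auto
  then have r: "\<chi> (b \<circ> inv' a) = (\<Sum>p\<in>{..<d} \<times> {..<d}. r p b * cnj (r p a))"
    if "a \<in> G" "b \<in> G" for a b
    using that G(4,5,7) \<chi> by (simp add: sym_group_mult)
  have "\<forall>l\<in>{1..m}. \<exists>u. \<forall>i\<in>{..<m}. \<forall>j\<in>{..<m}. A (f l) $$ (i, j) = (\<Sum>k\<in>{..<m}. u k i * cnj (u k j))"
    using pos_kernel_gram[OF finite_lessThan pos_kernel_hermitian_psd[OF psd]] by blast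
  then obtain u where u: "\<And>l i j. l \<in> {1..m} \<Longrightarrow> i < m \<Longrightarrow> j < m \<Longrightarrow>
      A (f l) $$ (i, j) = (\<Sum>k<m. u l k i * cnj (u l k j))"
    by (metis lessThan_iff bchoice)
  define w where "w q a = (\<Prod>l=1..m. u l (q l) (a l - 1))" for q a :: "nat \<Rightarrow> nat"
  have w: "(\<Prod>l=1..m. A (f l) $$ (a l - 1, b l - 1)) = (\<Sum>q\<in>{1..m} \<rightarrow>\<^sub>E {..<m}. w q a * cnj (w q b))"
    if "a \<in> G" "b \<in> G" for a b
  proof -
    have "A (f l) $$ (a l - 1, b l - 1) = (\<Sum>k<m. u l k (a l - 1) * cnj (u l k (b l - 1)))"
      if l: "l \<in> {1..m}" for l
      using l permutes_in_image[OF G(1)[OF \<open>a \<in> G\<close>], of l] permutes_in_image[OF G(1)[OF \<open>b \<in> G\<close>], of l]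
      by (intro u) auto
    then have "(\<Prod>l=1..m. A (f l) $$ (a l - 1, b l - 1)) =
        (\<Prod>l=1..m. \<Sum>k<m. u l k (a l - 1) * cnj (u l k (b l - 1)))"
      by (intro prod.cong) auto
    also have "\<dots> = (\<Sum>q\<in>{1..m} \<rightarrow>\<^sub>E {..<m}. w q a * cnj (w q b))"
      unfolding w_def cnj_prod prod.distrib[symmetric] by (rule prod_sum_PiE) auto
    finally show ?thesis .
  qed
  have "(\<Sum>\<tau>\<in>G. mixed_immanant m G \<chi> A (f \<circ> \<tau>)) =
      (\<Sum>a\<in>G. \<Sum>b\<in>G. (\<Sum>p\<in>{..<d} \<times> {..<d}. r p b * cnj (r p a)) *
         (\<Sum>q\<in>{1..m} \<rightarrow>\<^sub>E {..<m}. w q a * cnj (w q b)))"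
    unfolding mixed_immanant_orbit_sum[OF sub]
    by (intro sum.cong refl) (simp only: r w)
  then show ?thesis using gram_pairing_nonneg by simp
qed

text \<open>Composition with an element of \<open>G\<close> permutes \<open>F\<close>, so \<open>|G|\<close> times the sum over \<open>F\<close> is a sum of
  orbit sums.\<close>

lemma mixed_immanant_sum_nonneg:
  assumes sub: "subgroup G (sym_group m)"
    and rep: "matrix_rep (sym_group m\<lparr>carrier := G\<rparr>) d \<rho>"
    and \<chi>: "\<And>g. g \<in> G \<Longrightarrow> \<chi> g = mat_trace (\<rho> g)"
    and psd: "\<And>f k. f \<in> F \<Longrightarrow> k \<in> {1..m} \<Longrightarrow> hermitian_psd m (A (f k))"
    and F: "\<And>f \<tau>. f \<in> F \<Longrightarrow> \<tau> \<in> G \<Longrightarrow> f \<circ> \<tau> \<in> F"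
  shows "0 \<le> (\<Sum>f\<in>F. mixed_immanant m G \<chi> A f)"
proof -
  note G = sym_subgroup_facts[OF sub]
  let ?D = "mixed_immanant m G \<chi> A"
  have reindex: "(\<Sum>f\<in>F. ?D (f \<circ> \<tau>)) = (\<Sum>f\<in>F. ?D f)" if "\<tau> \<in> G" for \<tau>
    by (rule sum.reindex_bij_witness[where i = "\<lambda>f. f \<circ> inv' \<tau>" and j = "\<lambda>f. f \<circ> \<tau>"])
       (use F G(5) that permutes_inv_o[OF G(1)[OF that]] in \<open>auto simp: comp_assoc\<close>)
  have "0 \<le> (\<Sum>f\<in>F. \<Sum>\<tau>\<in>G. ?D (f \<circ> \<tau>))"
    using psd by (intro sum_nonneg mixed_immanant_orbit_nonneg[OF sub rep \<chi>]) auto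
  also have "\<dots> = (\<Sum>\<tau>\<in>G. \<Sum>f\<in>F. ?D (f \<circ> \<tau>))" by (rule sum.swap)
  also have "\<dots> = of_nat (card G) * (\<Sum>f\<in>F. ?D f)" using reindex by simp
  finally have "0 \<le> of_nat (card G) * (\<Sum>f\<in>F. ?D f)" .
  moreover have "card G > 0" using G(2,3) card_gt_0_iff by blast
  ultimately show ?thesis by (auto simp: less_eq_complex_def zero_le_mult_iff)
qed

section \<open>The inequality\<close>

text \<open>The total weight with which a mixed immanant whose index function has range \<open>R\<close> enters
  the difference of the two sides of the inequality. A singleton \<open>R\<close> lies in one of the singletons
  and in \<open>n - 1\<close> of the pairs, which gives \<open>(n - 2) + 1 - (n - 1) = 0\<close>; a two-element \<open>R\<close> lies in no
  singleton and in one pair; a larger \<open>R\<close> is counted by the full sum alone.\<close>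

lemma inclusion_exclusion_coeff:
  fixes R :: "nat set"
  assumes "R \<subseteq> {1..n}" "R \<noteq> {}"
  shows "(of_nat n - 2) * of_nat (card {i\<in>{1..n}. R \<subseteq> {i}}) + 1 -
     of_nat (card {(i, j). 1 \<le> i \<and> i < j \<and> j \<le> n \<and> R \<subseteq> {i, j}}) =
     (if card R \<ge> 3 then 1 else (0 :: complex))"
proof -
  have fin: "finite R" using assms(1) finite_subset by blast
  let ?P = "{(i, j). 1 \<le> i \<and> i < j \<and> j \<le> n \<and> R \<subseteq> {i, j}}"
  have "card R > 0" using assms(2) fin by (simp add: card_gt_0_iff)
  then consider "card R = 1" | "card R = 2" | "card R \<ge> 3" by linarith
  then show ?thesis
  proof cases
    case 1
    then obtain a where a: "R = {a}" by (auto simp: card_1_singleton_iff)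
    then have an: "1 \<le> a" "a \<le> n" using assms(1) by auto
    have "{i\<in>{1..n}. R \<subseteq> {i}} = {a}" using a an by auto
    moreover have "?P = (\<lambda>b. (min a b, max a b)) ` ({1..n} - {a})"
    proof (rule Set.set_eqI)
      fix p :: "nat \<times> nat"
      obtain i j where p: "p = (i, j)" by (cases p)
      show "p \<in> ?P \<longleftrightarrow> p \<in> (\<lambda>b. (min a b, max a b)) ` ({1..n} - {a})"
      proof
        assume "p \<in> ?P"
        then have "1 \<le> i" "i < j" "j \<le> n" "a = i \<or> a = j" using a p by auto
        then show "p \<in> (\<lambda>b. (min a b, max a b)) ` ({1..n} - {a})"
          unfolding p by (intro image_eqI[where x = "if a = i then j else i"]) auto
      next
        assume "p \<in> (\<lambda>b. (min a b, max a b)) ` ({1..n} - {a})"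
        then obtain b where "p = (min a b, max a b)" "b \<in> {1..n} - {a}" by blast
        then show "p \<in> ?P" unfolding a using an by (cases "a < b") auto
      qed
    qed
    moreover have "card ((\<lambda>b. (min a b, max a b)) ` ({1..n} - {a})) = n - 1"
      using an by (subst card_image) (auto simp: inj_on_def min_def max_def split: if_splits)
    ultimately show ?thesis using 1 an by (simp add: of_nat_diff)
  next
    case 2
    then obtain a b where ab: "R = {a, b}" "a \<noteq> b" by (auto simp: card_2_iff)
    then have "{i\<in>{1..n}. R \<subseteq> {i}} = {}" by auto
    moreover have "?P = {(min a b, max a b)}"
      using ab assms(1) by (auto simp: min_def max_def split: if_splits)
    ultimately show ?thesis using 2 by simp
  next
    case 3
    have two: "\<not> R \<subseteq> {i, j}" for i j
    proof
      assume "R \<subseteq> {i, j}"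
      then have "card R \<le> card {i, j}" by (rule card_mono[rotated]) simp
      also have "\<dots> \<le> 2" by (cases "i = j") auto
      finally show False using 3 by simp
    qed
    moreover have "\<not> R \<subseteq> {i}" for i using two[of i i] by simp
    ultimately show ?thesis using 3 by simp
  qed
qed

theorem corollary4p4:
  fixes m n :: nat
    and G :: "(nat \<Rightarrow> nat) set"
    and \<chi> :: "(nat \<Rightarrow> nat) \<Rightarrow> complex"
    and A :: "nat \<Rightarrow> complex mat"
  assumes "m \<ge> 1" and "n \<ge> 1"
    and "subgroup G (sym_group m)"
    and "irreducible_character (sym_group m\<lparr>carrier := G\<rparr>) \<chi>"
    and "\<And>i. i \<in> {1..n} \<Longrightarrow> hermitian_psd m (A i)"
  shows "(of_nat n - 2) * (\<Sum>i=1..n. immanant m G \<chi> (A i))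
           + immanant m G \<chi> (finsum (module_mat TYPE(complex) m m) A {1..n})
         \<ge> (\<Sum>(i, j) | 1 \<le> i \<and> i < j \<and> j \<le> n. immanant m G \<chi> (A i + A j))"
proof -
  note G = sym_subgroup_facts[OF assms(3)]
  obtain d \<rho> where rep: "matrix_rep (sym_group m\<lparr>carrier := G\<rparr>) d \<rho>"
    and \<chi>: "\<And>g. g \<in> G \<Longrightarrow> \<chi> g = mat_trace (\<rho> g)"
    using assms(4) unfolding irreducible_character_def irreducible_rep_def by auto
  have carr: "A i \<in> carrier_mat m m" if "i \<in> {1..n}" for i
    using assms(5)[OF that] unfolding hermitian_psd_def by blast
  let ?D = "mixed_immanant m G \<chi> A"
  let ?P = "{(i, j). 1 \<le> i \<and> i < j \<and> j \<le> n}"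
  define E where "E = {1..m} \<rightarrow>\<^sub>E {1..n}"
  have finE: "finite E" unfolding E_def by (intro finite_PiE) auto
  have finP: "finite ?P" by (rule finite_subset[of _ "{1..n} \<times> {1..n}"]) auto
  have expand: "immanant m G \<chi> X = (\<Sum>f\<in>E. if f ` {1..m} \<subseteq> S then ?D f else 0)"
    if "S \<subseteq> {1..n}" "\<And>i j. i < m \<Longrightarrow> j < m \<Longrightarrow> X $$ (i, j) = (\<Sum>s\<in>S. A s $$ (i, j))" for X S
  proof -
    have "({1..m} \<rightarrow>\<^sub>E S) = {f\<in>E. f ` {1..m} \<subseteq> S}"
      unfolding E_def using that(1) by (auto simp: PiE_def Pi_def extensional_def)
    then show ?thesis
      using immanant_sum_expand[OF G(1) finite_subset[OF that(1)], where X = X and A = A and \<chi> = \<chi>] that(2) finE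
      by (simp add: sum.inter_filter)
  qed
  have one: "(\<Sum>i=1..n. immanant m G \<chi> (A i)) =
      (\<Sum>f\<in>E. of_nat (card {i\<in>{1..n}. f ` {1..m} \<subseteq> {i}}) * ?D f)"
  proof -
    have "(\<Sum>i=1..n. immanant m G \<chi> (A i)) =
        (\<Sum>i=1..n. \<Sum>f\<in>E. if f ` {1..m} \<subseteq> {i} then ?D f else 0)"
      by (intro sum.cong refl expand) auto
    also have "\<dots> = (\<Sum>f\<in>E. \<Sum>i=1..n. if f ` {1..m} \<subseteq> {i} then ?D f else 0)" by (rule sum.swap)
    also have "\<dots> = (\<Sum>f\<in>E. of_nat (card {i\<in>{1..n}. f ` {1..m} \<subseteq> {i}}) * ?D f)"
      by (intro sum.cong refl, subst sum.inter_filter[symmetric]) auto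
    finally show ?thesis .
  qed
  have two: "(\<Sum>(i, j)\<in>?P. immanant m G \<chi> (A i + A j)) =
      (\<Sum>f\<in>E. of_nat (card {(i, j). 1 \<le> i \<and> i < j \<and> j \<le> n \<and> f ` {1..m} \<subseteq> {i, j}}) * ?D f)"
  proof -
    have "(\<Sum>(i, j)\<in>?P. immanant m G \<chi> (A i + A j)) =
        (\<Sum>p\<in>?P. \<Sum>f\<in>E. if f ` {1..m} \<subseteq> {fst p, snd p} then ?D f else 0)"
    proof (intro sum.cong refl, clarsimp)
      fix i j assume ij: "Suc 0 \<le> i" "i < j" "j \<le> n"
      show "immanant m G \<chi> (A i + A j) =
          (\<Sum>f\<in>E. if f ` {Suc 0..m} \<subseteq> {i, j} then ?D f else 0)"
        by (rule expand[of "{i, j}", simplified]) (use ij carr[of i] carr[of j] in auto)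
    qed
    also have "\<dots> = (\<Sum>f\<in>E. \<Sum>p\<in>?P. if f ` {1..m} \<subseteq> {fst p, snd p} then ?D f else 0)" by (rule sum.swap)
    also have "\<dots> = (\<Sum>f\<in>E. of_nat (card {p\<in>?P. f ` {1..m} \<subseteq> {fst p, snd p}}) * ?D f)"
      using finP by (intro sum.cong refl, subst sum.inter_filter[symmetric]) auto
    also have "\<dots> = (\<Sum>f\<in>E. of_nat (card {(i, j). 1 \<le> i \<and> i < j \<and> j \<le> n \<and> f ` {1..m} \<subseteq> {i, j}}) * ?D f)"
      by (intro sum.cong refl arg_cong2[where f = "(*)"] arg_cong[where f = of_nat] arg_cong[where f = card]) auto
    finally show ?thesis .
  qed
  have all: "immanant m G \<chi> (finsum (module_mat TYPE(complex) m m) A {1..n}) = (\<Sum>f\<in>E. ?D f)"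
  proof -
    have "immanant m G \<chi> (finsum (module_mat TYPE(complex) m m) A {1..n}) =
        (\<Sum>f\<in>E. if f ` {1..m} \<subseteq> {1..n} then ?D f else 0)"
      by (rule expand) (use carr in \<open>auto intro!: index_finsum_mat\<close>)
    also have "\<dots> = (\<Sum>f\<in>E. ?D f)" by (intro sum.cong refl) (auto simp: E_def)
    finally show ?thesis .
  qed
  have "(of_nat n - 2) * (\<Sum>i=1..n. immanant m G \<chi> (A i))
           + immanant m G \<chi> (finsum (module_mat TYPE(complex) m m) A {1..n})
         - (\<Sum>(i, j)\<in>?P. immanant m G \<chi> (A i + A j)) =
      (\<Sum>f\<in>E. ((of_nat n - 2) * of_nat (card {i\<in>{1..n}. f ` {1..m} \<subseteq> {i}}) + 1 -
        of_nat (card {(i, j). 1 \<le> i \<and> i < j \<and> j \<le> n \<and> f ` {1..m} \<subseteq> {i, j}})) * ?D f)"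
    unfolding one two all
    by (simp add: sum_distrib_left sum.distrib sum_subtractf algebra_simps)
  also have "\<dots> = (\<Sum>f\<in>E. (if card (f ` {1..m}) \<ge> 3 then 1 else 0) * ?D f)"
  proof (rule sum.cong[OF refl])
    fix f assume "f \<in> E"
    then have "f ` {1..m} \<subseteq> {1..n}" "f ` {1..m} \<noteq> {}" using assms(1) by (auto simp: E_def)
    from inclusion_exclusion_coeff[OF this]
    show "((of_nat n - 2) * of_nat (card {i\<in>{1..n}. f ` {1..m} \<subseteq> {i}}) + 1 -
        of_nat (card {(i, j). 1 \<le> i \<and> i < j \<and> j \<le> n \<and> f ` {1..m} \<subseteq> {i, j}})) * ?D f =
        (if card (f ` {1..m}) \<ge> 3 then 1 else 0) * ?D f"
      by presburger
  qed
  also have "\<dots> = (\<Sum>f | f \<in> E \<and> card (f ` {1..m}) \<ge> 3. ?D f)"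
    using finE by (simp add: sum.inter_filter if_distrib if_distribR cong: if_cong)
  also have "0 \<le> \<dots>"
  proof (rule mixed_immanant_sum_nonneg[OF assms(3) rep \<chi>])
    fix f k assume "f \<in> {f \<in> E. card (f ` {1..m}) \<ge> 3}" "k \<in> {1..m}"
    then have "f k \<in> {1..n}" unfolding E_def by blast
    then show "hermitian_psd m (A (f k))" by (rule assms(5))
  next
    fix f \<tau> assume f: "f \<in> {f \<in> E. card (f ` {1..m}) \<ge> 3}" and \<tau>: "\<tau> \<in> G"
    note p = G(1)[OF \<tau>]
    have "f \<circ> \<tau> \<in> E"
      using f permutes_in_image[OF p] permutes_not_in[OF p]
      by (auto simp: E_def PiE_def Pi_def extensional_def)
    moreover have "(f \<circ> \<tau>) ` {1..m} = f ` {1..m}"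
      by (metis image_comp permutes_image[OF p])
    ultimately show "f \<circ> \<tau> \<in> {f \<in> E. card (f ` {1..m}) \<ge> 3}" using f by simp
  qed auto
  finally show ?thesis by simp
qed

end
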